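(* Let $D=(V,A)$ be a finite directed acyclic graph (DAG). The following four statements are equivalent: (1) $D$ is a funnel. (2) For every vertex $v\in V$ with in-degree $\deg^-(v)>1$, every vertex $u$ reachable from $v$ by a directed path (including $u=v$) satisfies $\deg^+(u)\le 1$. (3) $D$ has no subgraph isomorphic to any digraph $D_k$, $k\in\{0,1,2,\dots\}$, where $D_k=(V_k,A_k)$ with $V_k=\{u_1,u_2,v_0,w_1,w_2\}\cup\{v_1,\dots,v_k\}$ (all distinct) and $A_k=\{(u_1,v_0),(u_2,v_0),(v_k,w_1),(v_k,w_2)\}\cup\{(v_i,v_{i+1}) : 0\le i\le k-1\}$. (4) Neither $D_0$ nor $D_1$ (as defined in (3)) is a topological minor of $D$.
   Context: A source is a vertex of in-degree $0$ and a sink is a vertex of out-degree $0$; $\deg^-(v)$ and $\deg^+(v)$ denote in- and out-degree. A source-sink path is a directed path from a source to a sink. An arc is private if exactly one source-sink path contains it. A DAG is a funnel if every source-sink path has at least one private arc. A digraph $H$ is a topological minor of $G$ if some subgraph of $G$ can be obtained from $H$ by subdividing arcs, i.e. replacing arcs by directed paths. In $D_0$ the vertex $v_k$ is $v_0$, so $A_0=\{(u_1,v_0),(u_2,v_0),(v_0,w_1),(v_0,w_2)\}$. *)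

theory Defs
  imports "Graph_Theory.Pair_Digraph" "Graph_Theory.Digraph_Isomorphism"
begin

text \<open>
  A DAG $D = (V,A)$ with $A \subseteq V \times V$ is a \<^typ>\<open>'a pair_pre_digraph\<close>; parallel arcs
  are thus excluded by the representation, and loops are excluded because
  \<^const>\<open>pre_digraph.cycle\<close> counts a loop as a cycle of length one.
\<close>

locale dag = pair_fin_digraph G for G :: "'a pair_pre_digraph" +
  assumes no_cycle: "\<nexists>p. cycle p"

definition source :: "('a, 'b) pre_digraph \<Rightarrow> 'a \<Rightarrow> bool" where
  "source G v \<longleftrightarrow> v \<in> verts G \<and> in_degree G v = 0"

definition sink :: "('a, 'b) pre_digraph \<Rightarrow> 'a \<Rightarrow> bool" where
  "sink G v \<longleftrightarrow> v \<in> verts G \<and> out_degree G v = 0"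

text \<open>
  Source-sink paths have at least one arc. Otherwise an isolated vertex, being both a source and
  a sink, would form a path without any arc, hence without a private one, and the
  characterizations of funnels would fail for each DAG with an isolated vertex.
\<close>

definition source_sink_path :: "('a, 'b) pre_digraph \<Rightarrow> 'b awalk \<Rightarrow> bool" where
  "source_sink_path G p \<longleftrightarrow>
     p \<noteq> [] \<and> (\<exists>s t. source G s \<and> sink G t \<and> pre_digraph.apath G s p t)"

definition private_arc :: "('a, 'b) pre_digraph \<Rightarrow> 'b \<Rightarrow> bool" where
  "private_arc G a \<longleftrightarrow> a \<in> arcs G \<and> (\<exists>!p. source_sink_path G p \<and> a \<in> set p)"

definition funnel :: "'a pair_pre_digraph \<Rightarrow> bool" where
  "funnel G \<longleftrightarrow> dag G \<and>
     (\<forall>p. source_sink_path (with_proj G) p \<longrightarrow> (\<exists>a \<in> set p. private_arc (with_proj G) a))"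

datatype D_vertex = U1 | U2 | V nat | W1 | W2

definition D_graph :: "nat \<Rightarrow> D_vertex pair_pre_digraph" where
  "D_graph k = \<lparr>
     pverts = {U1, U2, V 0, W1, W2} \<union> {V i | i. 1 \<le> i \<and> i \<le> k},
     parcs = {(U1, V 0), (U2, V 0), (V k, W1), (V k, W2)} \<union> {(V i, V (i + 1)) | i. i < k} \<rparr>"

definition has_subgraph_iso :: "'a pair_pre_digraph \<Rightarrow> 'b pair_pre_digraph \<Rightarrow> bool" where
  "has_subgraph_iso G H \<longleftrightarrow>
     (\<exists>S. subgraph (with_proj S) (with_proj G) \<and> digraph_iso (with_proj H) (with_proj S))"

text \<open>
  The arc $(u,v)$ is replaced by the directed path through $u$, the vertices of \<open>ws\<close> in order,
  and $v$. The empty list leaves a digraph that contains $(u,v)$ unchanged.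
\<close>

definition replace_arc :: "'a pair_pre_digraph \<Rightarrow> 'a \<Rightarrow> 'a \<Rightarrow> 'a list \<Rightarrow> 'a pair_pre_digraph" where
  "replace_arc H u v ws = \<lparr>
     pverts = pverts H \<union> set ws,
     parcs = (parcs H - {(u, v)}) \<union> set (zip (u # ws) (ws @ [v])) \<rparr>"

inductive arc_subdivision :: "'a pair_pre_digraph \<Rightarrow> 'a pair_pre_digraph \<Rightarrow> bool" for H where
  refl: "arc_subdivision H H"
| step: "\<lbrakk>arc_subdivision H K; (u, v) \<in> parcs K; distinct ws; set ws \<inter> pverts K = {}\<rbrakk>
    \<Longrightarrow> arc_subdivision H (replace_arc K u v ws)"

text \<open>
  Subdividing never removes vertices, so an isomorphic copy \<open>H'\<close> of \<open>H\<close> can be chosen on vertices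
  of \<open>S\<close>; its arcs need not be arcs of \<open>G\<close>. Passing to the copy first ensures that the vertex type
  of \<open>H\<close> does not limit the supply of fresh vertices.
\<close>

definition topological_minor :: "'b pair_pre_digraph \<Rightarrow> 'a pair_pre_digraph \<Rightarrow> bool" where
  "topological_minor H G \<longleftrightarrow>
     (\<exists>H' S. digraph_iso (with_proj H) (with_proj H') \<and> arc_subdivision H' S \<and>
       subgraph (with_proj S) (with_proj G))"

end

theory Submission
  imports Defs
begin

text \<open>
  All four conditions say that a vertex with two in-arcs never reaches a vertex with two out-arcs;
  \<open>merge_split\<close> is the negation of this. Suppose that \<open>v\<close> has the in-neighbours \<open>x\<^sub>1, x\<^sub>2\<close>, that
  it reaches \<open>u\<close>, and that \<open>u\<close> has the out-neighbours \<open>w\<^sub>1, w\<^sub>2\<close>. A source-sink path through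
  \<open>x\<^sub>1, v, u, w\<^sub>1\<close> has no private arc, because its part up to \<open>u\<close> can be continued through \<open>w\<^sub>2\<close>
  and its part from \<open>v\<close> on can be entered through \<open>x\<^sub>2\<close>. Conversely, if there is no such
  configuration, then each source-sink path has an arc such that all vertices before it have at
  most one in-arc and all vertices after it have at most one out-arc, and this arc is private.
  Acyclicity makes the vertices of a configuration distinct, which gives a copy of some \<open>D\<^sub>k\<close>. For
  \<open>k > 0\<close> this is a subdivision of \<open>D\<^sub>1\<close>, and subdividing preserves configurations.
\<close>

section \<open>Merging followed by splitting\<close>

definition merge_split :: "'a rel \<Rightarrow> bool" where
  "merge_split A \<longleftrightarrow> (\<exists>x1 x2 v u w1 w2. x1 \<noteq> x2 \<and> (x1, v) \<in> A \<and> (x2, v) \<in> A \<and>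
     (v, u) \<in> A\<^sup>* \<and> (u, w1) \<in> A \<and> (u, w2) \<in> A \<and> w1 \<noteq> w2)"

lemma merge_splitI:
  assumes "x1 \<noteq> x2" "(x1, v) \<in> A" "(x2, v) \<in> A" "(v, u) \<in> A\<^sup>*"
    "(u, w1) \<in> A" "(u, w2) \<in> A" "w1 \<noteq> w2"
  shows "merge_split A"
  using assms unfolding merge_split_def by blast

lemma merge_splitE:
  assumes "merge_split A"
  obtains x1 x2 v u w1 w2 where "x1 \<noteq> x2" "(x1, v) \<in> A" "(x2, v) \<in> A" "(v, u) \<in> A\<^sup>*"
    "(u, w1) \<in> A" "(u, w2) \<in> A" "w1 \<noteq> w2"
  using assms unfolding merge_split_def by blast

lemma merge_split_mono:
  assumes "merge_split A" "A \<subseteq> B"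
  shows "merge_split B"
proof -
  from assms(1) obtain x1 x2 v u w1 w2 where "x1 \<noteq> x2" "(x1, v) \<in> A" "(x2, v) \<in> A"
    "(v, u) \<in> A\<^sup>*" "(u, w1) \<in> A" "(u, w2) \<in> A" "w1 \<noteq> w2" by (rule merge_splitE)
  with assms(2) rtrancl_mono[OF assms(2)] show ?thesis
    by (intro merge_splitI[of x1 x2 v B u w1 w2]) auto
qed

lemma rtrancl_map_prod: "(x, y) \<in> A\<^sup>* \<Longrightarrow> (f x, f y) \<in> (map_prod f f ` A)\<^sup>*"
proof (induction rule: rtrancl_induct)
  case (step y z)
  then have "(f y, f z) \<in> map_prod f f ` A" by force
  with step.IH show ?case by (rule rtrancl_into_rtrancl)
qed simp

text \<open>Any map preserves the walk from \<open>v\<close> to \<open>u\<close>; injectivity keeps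
  the two in-neighbours and the two out-neighbours apart.\<close>

lemma merge_split_map_prod:
  assumes "merge_split A" "A \<subseteq> S \<times> S" "inj_on f S"
  shows "merge_split (map_prod f f ` A)"
proof -
  from assms(1) obtain x1 x2 v u w1 w2 where *: "x1 \<noteq> x2" "(x1, v) \<in> A" "(x2, v) \<in> A"
    "(v, u) \<in> A\<^sup>*" "(u, w1) \<in> A" "(u, w2) \<in> A" "w1 \<noteq> w2" by (rule merge_splitE)
  have "f x1 \<noteq> f x2" "f w1 \<noteq> f w2"
    using * assms(2,3) by (auto dest!: inj_onD)
  moreover have "(f x, f y) \<in> map_prod f f ` A" if "(x, y) \<in> A" for x y
    using that by force
  ultimately show ?thesis
    using * rtrancl_map_prod[OF *(4)] by (intro merge_splitI[of "f x1" "f x2" "f v" _ "f u" "f w1" "f w2"]) auto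
qed

section \<open>Subdivisions\<close>

text \<open>\<open>zip (u # ws) (ws @ [v])\<close> lists the arcs of the path
  \<open>u, ws, v\<close>; for \<open>ws = []\<close> it is the single arc
  \<open>(u, v)\<close>.\<close>

lemma path_zip: "(u, v) \<in> (set (zip (u # ws) (ws @ [v])))\<^sup>*"
proof (induction ws arbitrary: u)
  case (Cons w ws)
  have "(w, v) \<in> (set (zip (u # w # ws) ((w # ws) @ [v])))\<^sup>*"
    by (rule subsetD[OF rtrancl_mono Cons.IH]) auto
  then show ?case by (rule converse_rtrancl_into_rtrancl[rotated]) auto
qed auto

lemma first_in_zip: "(u, hd (ws @ [v])) \<in> set (zip (u # ws) (ws @ [v]))"
  by (cases ws) auto

lemma last_in_zip: "(last (u # ws), v) \<in> set (zip (u # ws) (ws @ [v]))"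
  by (induction ws arbitrary: u) auto

lemma set_zip_shift_subset:
  "set (zip (u # ws) (ws @ [v])) \<subseteq> (insert u (set ws)) \<times> (insert v (set ws))"
  by (auto dest: set_zip_leftD set_zip_rightD)

lemma pair_wf_digraph_iff: "pair_wf_digraph G \<longleftrightarrow> parcs G \<subseteq> pverts G \<times> pverts G"
  unfolding pair_wf_digraph_def by auto

lemma pair_wf_digraph_replace_arc:
  assumes "pair_wf_digraph K" "(u, v) \<in> parcs K"
  shows "pair_wf_digraph (replace_arc K u v ws)"
proof -
  have "parcs K \<subseteq> pverts K \<times> pverts K" "u \<in> pverts K" "v \<in> pverts K"
    using assms by (auto simp: pair_wf_digraph_iff)
  then show ?thesis
    using set_zip_shift_subset[of u ws v] unfolding pair_wf_digraph_iff replace_arc_def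
    by (simp del: zip_Cons_Cons) blast
qed

text \<open>The merging and the splitting vertex stay. If an arc at one of them is subdivided, the
  last or first arc of the replacing path takes over its role.\<close>

lemma merge_split_replace_arc:
  assumes "pair_wf_digraph K" "(u, v) \<in> parcs K" "set ws \<inter> pverts K = {}"
    and "merge_split (parcs K)"
  shows "merge_split (parcs (replace_arc K u v ws))"
proof -
  let ?A = "parcs K" and ?B = "parcs (replace_arc K u v ws)"
  \<comment> \<open>\<open>pre x y\<close> is the new in-neighbour of \<open>y\<close>, and
    \<open>suc x y\<close> the new out-neighbour of \<open>x\<close>, on what the arc
    \<open>(x, y)\<close> has become.\<close>
  define pre where "pre x y = (if (x, y) = (u, v) then last (u # ws) else x)" for x y
  define suc where "suc x y = (if (x, y) = (u, v) then hd (ws @ [v]) else y)" for x y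
  have wf: "x \<in> pverts K \<and> y \<in> pverts K" if "(x, y) \<in> ?A" for x y
    using assms(1) that by (auto simp: pair_wf_digraph_iff)
  have zip_sub: "set (zip (u # ws) (ws @ [v])) \<subseteq> ?B" by (auto simp: replace_arc_def)
  have pre: "(pre x y, y) \<in> ?B" and suc: "(x, suc x y) \<in> ?B" if "(x, y) \<in> ?A" for x y
    using that zip_sub first_in_zip[of u ws v] last_in_zip[of u ws v]
    by (auto simp: pre_def suc_def replace_arc_def)
  have "last (u # ws) \<in> {u} \<union> set ws" "hd (ws @ [v]) \<in> {v} \<union> set ws"
    by (cases ws; simp)+
  then have fresh: "last (u # ws) = u \<or> last (u # ws) \<notin> pverts K"
    "hd (ws @ [v]) = v \<or> hd (ws @ [v]) \<notin> pverts K"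
    using assms(3) by auto
  \<comment> \<open>At most one of the two arcs into \<open>y\<close> is \<open>(u, v)\<close>. Its
    new tail is \<open>u\<close> or a fresh vertex, so it differs from the tail of the other arc,
    which is an old vertex.\<close>
  have pre_inj: "pre x y \<noteq> pre x' y" if "(x, y) \<in> ?A" "(x', y) \<in> ?A" "x \<noteq> x'" for x x' y
    using that fresh(1) wf unfolding pre_def by (metis prod.inject)
  have suc_inj: "suc x y \<noteq> suc x y'" if "(x, y) \<in> ?A" "(x, y') \<in> ?A" "y \<noteq> y'" for x y y'
    using that fresh(2) wf unfolding suc_def by (metis prod.inject)
  have "?A \<subseteq> ?B\<^sup>*"
    using path_zip[of u v ws] rtrancl_mono[OF zip_sub] by (auto simp: replace_arc_def)
  then have reach: "?A\<^sup>* \<subseteq> ?B\<^sup>*" by (rule rtrancl_subset_rtrancl)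
  from assms(4) obtain x1 x2 a b w1 w2 where *: "x1 \<noteq> x2" "(x1, a) \<in> ?A" "(x2, a) \<in> ?A"
    "(a, b) \<in> ?A\<^sup>*" "(b, w1) \<in> ?A" "(b, w2) \<in> ?A" "w1 \<noteq> w2" by (rule merge_splitE)
  show ?thesis
    by (rule merge_splitI[of "pre x1 a" "pre x2 a" a _ b "suc b w1" "suc b w2"])
      (use * reach pre suc pre_inj suc_inj in auto)
qed

lemma merge_split_arc_subdivision:
  assumes "arc_subdivision H S" "pair_wf_digraph H" "merge_split (parcs H)"
  shows "pair_wf_digraph S \<and> merge_split (parcs S)"
  using assms
  by induction (auto intro: pair_wf_digraph_replace_arc merge_split_replace_arc)

section \<open>Embeddings of the digraphs \<open>D\<^sub>k\<close>\<close>

definition map_digraph :: "('a \<Rightarrow> 'b) \<Rightarrow> 'a pair_pre_digraph \<Rightarrow> 'b pair_pre_digraph" where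
  "map_digraph f G = \<lparr>pverts = f ` pverts G, parcs = map_prod f f ` parcs G\<rparr>"

lemma map_digraph_simps [simp]:
  "pverts (map_digraph f G) = f ` pverts G"
  "parcs (map_digraph f G) = map_prod f f ` parcs G"
  by (simp_all add: map_digraph_def)

lemma pair_wf_map_digraph: "pair_wf_digraph G \<Longrightarrow> pair_wf_digraph (map_digraph f G)"
  by (auto simp: pair_wf_digraph_iff)

text \<open>Both digraphs take tails and heads from \<open>fst\<close> and \<open>snd\<close>, so
  the vertex map forces the arc map to act componentwise. An isomorphism thus amounts to an
  injective renaming of vertices.\<close>

lemma digraph_iso_with_proj_iff:
  "digraph_iso (with_proj G) (with_proj H) \<longleftrightarrow>
     pair_wf_digraph G \<and> (\<exists>f. inj_on f (pverts G) \<and> H = map_digraph f G)"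
proof
  assume "digraph_iso (with_proj G) (with_proj H)"
  then obtain h where h: "pre_digraph.digraph_isomorphism (with_proj G) h"
    and H: "with_proj H = app_iso h (with_proj G)"
    unfolding digraph_iso_def by auto
  from H have "iso_tail h = fst" "iso_head h = snd"
    and *: "pverts H = iso_verts h ` pverts G" "parcs H = iso_arcs h ` parcs G"
    by (auto simp: with_proj_def app_iso_def)
  with h have "\<forall>a \<in> parcs G. iso_arcs h a = map_prod (iso_verts h) (iso_verts h) a"
    by (auto simp: pre_digraph.digraph_isomorphism_def prod_eq_iff)
  with * have "H = map_digraph (iso_verts h) G"
    by (intro pair_pre_digraph.equality) (auto intro!: image_cong)
  with h show "pair_wf_digraph G \<and> (\<exists>f. inj_on f (pverts G) \<and> H = map_digraph f G)"
    by (auto simp: pre_digraph.digraph_isomorphism_def wf_digraph_wp_iff)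
next
  assume "pair_wf_digraph G \<and> (\<exists>f. inj_on f (pverts G) \<and> H = map_digraph f G)"
  then obtain f where wf: "pair_wf_digraph G" and f: "inj_on f (pverts G)" "H = map_digraph f G"
    by auto
  let ?h = "\<lparr>iso_verts = f, iso_arcs = map_prod f f, iso_head = snd, iso_tail = fst\<rparr>"
  have "inj_on (map_prod f f) (parcs G)"
    using map_prod_inj_on[OF f(1) f(1)] wf
    by (auto simp: pair_wf_digraph_iff intro: inj_on_subset)
  then have "pre_digraph.digraph_isomorphism (with_proj G) ?h"
    using wf f by (auto simp: pre_digraph.digraph_isomorphism_def wf_digraph_wp_iff)
  moreover have "with_proj H = app_iso ?h (with_proj G)"
    by (simp add: f with_proj_def app_iso_def)
  ultimately show "digraph_iso (with_proj G) (with_proj H)"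
    unfolding digraph_iso_def by blast
qed

lemma subgraph_with_proj_iff:
  "subgraph (with_proj S) (with_proj G) \<longleftrightarrow> pverts S \<subseteq> pverts G \<and> parcs S \<subseteq> parcs G \<and>
     pair_wf_digraph S \<and> pair_wf_digraph G"
  by (auto simp: subgraph_def compatible_def wf_digraph_wp_iff)

lemma pverts_D_graph: "pverts (D_graph k) = {U1, U2, W1, W2} \<union> V ` {..k}"
  by (auto simp: D_graph_def image_iff Suc_le_eq)

lemma parcs_D_graph: "parcs (D_graph k) =
  {(U1, V 0), (U2, V 0), (V k, W1), (V k, W2)} \<union> (\<lambda>i. (V i, V (Suc i))) ` {..<k}"
  by (auto simp: D_graph_def)

lemma pair_wf_D_graph: "pair_wf_digraph (D_graph k)"
  unfolding pair_wf_digraph_iff pverts_D_graph parcs_D_graph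
  by (simp add: image_subset_iff image_iff Suc_le_eq)

lemma merge_split_D_graph: "merge_split (parcs (D_graph k))"
proof -
  have "(V 0, V i) \<in> (parcs (D_graph k))\<^sup>*" if "i \<le> k" for i
    using that
  proof (induction i)
    case (Suc i)
    then have "(V i, V (Suc i)) \<in> parcs (D_graph k)" by (auto simp: D_graph_def)
    with Suc show ?case by (auto intro: rtrancl_into_rtrancl)
  qed simp
  then show ?thesis
    by (intro merge_splitI[of U1 U2 "V 0" _ "V k" W1 W2]) (auto simp: D_graph_def)
qed

lemma has_subgraph_iso_D_graph_imp_merge_split:
  assumes "has_subgraph_iso D (D_graph k)"
  shows "merge_split (parcs D)"
proof -
  from assms obtain f where f: "inj_on f (pverts (D_graph k))"
    and "parcs (map_digraph f (D_graph k)) \<subseteq> parcs D"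
    by (auto simp: has_subgraph_iso_def digraph_iso_with_proj_iff subgraph_with_proj_iff)
  moreover have "merge_split (parcs (map_digraph f (D_graph k)))"
    using merge_split_map_prod[OF merge_split_D_graph _ f] pair_wf_D_graph
    by (auto simp: pair_wf_digraph_iff)
  ultimately show ?thesis by (blast intro: merge_split_mono)
qed

text \<open>The configuration passes from \<open>D_graph k\<close> to its renamed copy, on to the
  subdivision, and from there to the larger arc set.\<close>

lemma topological_minor_D_graph_imp_merge_split:
  assumes "topological_minor (D_graph k) D"
  shows "merge_split (parcs D)"
proof -
  from assms obtain f S where f: "inj_on f (pverts (D_graph k))"
    and S: "arc_subdivision (map_digraph f (D_graph k)) S" "parcs S \<subseteq> parcs D"
    by (auto simp: topological_minor_def digraph_iso_with_proj_iff subgraph_with_proj_iff)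
  have "merge_split (parcs (map_digraph f (D_graph k)))"
    using merge_split_map_prod[OF merge_split_D_graph _ f] pair_wf_D_graph
    by (auto simp: pair_wf_digraph_iff)
  with S show ?thesis
    using merge_split_arc_subdivision pair_wf_map_digraph[OF pair_wf_D_graph]
    by (blast intro: merge_split_mono)
qed

text \<open>The image need not be an induced subdigraph. This is the common source of the subgraphs
  in (3) and the minors in (4).\<close>

definition embeds :: "('a \<Rightarrow> 'b) \<Rightarrow> 'a pair_pre_digraph \<Rightarrow> 'b pair_pre_digraph \<Rightarrow> bool" where
  "embeds f H G \<longleftrightarrow> inj_on f (pverts H) \<and> f ` pverts H \<subseteq> pverts G \<and>
     map_prod f f ` parcs H \<subseteq> parcs G"

lemma embeds_imp_has_subgraph_iso:
  assumes "embeds f H G" "pair_wf_digraph H" "pair_wf_digraph G"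
  shows "has_subgraph_iso G H"
  unfolding has_subgraph_iso_def digraph_iso_with_proj_iff subgraph_with_proj_iff
  using assms
  by (intro exI[of _ "map_digraph f H"]) (auto simp: embeds_def intro: pair_wf_map_digraph)

lemma embeds_imp_topological_minor:
  assumes "embeds f H G" "pair_wf_digraph H" "pair_wf_digraph G"
  shows "topological_minor H G"
  unfolding topological_minor_def digraph_iso_with_proj_iff subgraph_with_proj_iff
  using assms
  by (intro exI[of _ "map_digraph f H"])
    (auto simp: embeds_def intro: pair_wf_map_digraph arc_subdivision.refl)

text \<open>The path from \<open>V 0\<close> to \<open>V k\<close> arises by subdividing one arc of
  a copy of \<open>D_graph 1\<close>. That arc itself may be missing from \<open>G\<close>; only the
  subdivided digraph has to lie in \<open>G\<close>.\<close>

lemma embeds_D_graph_imp_topological_minor: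
  assumes emb: "embeds f (D_graph k) G" and "k > 0" and wf: "pair_wf_digraph G"
  shows "topological_minor (D_graph 1) G"
proof -
  \<comment> \<open>The copy of \<open>D_graph 1\<close> puts \<open>V 1\<close> at the end of the
    long path; \<open>ws\<close> collects the interior vertices and is empty for
    \<open>k = 1\<close>.\<close>
  define g where "g = f(V 1 := f (V k))"
  define ws where "ws = map (\<lambda>i. f (V i)) [1..<k]"
  define S where "S = replace_arc (map_digraph g (D_graph 1)) (f (V 0)) (f (V k)) ws"
  note verts = pverts_D_graph
  have inj: "inj_on f (pverts (D_graph k))" and sub: "f ` pverts (D_graph k) \<subseteq> pverts G"
    and arcs: "\<And>x y. (x, y) \<in> parcs (D_graph k) \<Longrightarrow> (f x, f y) \<in> parcs G"
    using emb unfolding embeds_def by auto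
  have f_eq: "f x = f y \<longleftrightarrow> x = y" if "x \<in> pverts (D_graph k)" "y \<in> pverts (D_graph k)" for x y
    using inj that by (auto dest: inj_onD)
  have verts1: "pverts (D_graph 1) = {U1, U2, W1, W2, V 0, V 1}"
    by (auto simp: verts atMost_Suc)
  have arcs1: "parcs (D_graph 1) = {(U1, V 0), (U2, V 0), (V 1, W1), (V 1, W2), (V 0, V 1)}"
    by (auto simp: D_graph_def)
  have inj_g: "inj_on g (pverts (D_graph 1))"
    using \<open>k > 0\<close> by (auto simp: verts1 g_def inj_on_def f_eq verts)
  have arcs_g: "parcs (map_digraph g (D_graph 1)) =
    {(f U1, f (V 0)), (f U2, f (V 0)), (f (V k), f W1), (f (V k), f W2), (f (V 0), f (V k))}"
    unfolding map_digraph_simps arcs1 by (simp add: g_def)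
  have verts_g: "pverts (map_digraph g (D_graph 1)) =
    {f U1, f U2, f W1, f W2, f (V 0), f (V k)}"
    unfolding map_digraph_simps verts1 by (simp add: g_def)
  have "arc_subdivision (map_digraph g (D_graph 1)) S"
    unfolding S_def
  proof (rule arc_subdivision.step[OF arc_subdivision.refl])
    show "distinct ws" using inj by (auto simp: ws_def distinct_map inj_on_def f_eq verts)
    show "set ws \<inter> pverts (map_digraph g (D_graph 1)) = {}"
      unfolding verts_g by (auto simp: ws_def f_eq verts)
  qed (unfold arcs_g, simp)
  moreover have "pair_wf_digraph S"
    unfolding S_def
    by (intro pair_wf_digraph_replace_arc pair_wf_map_digraph pair_wf_D_graph)
      (unfold arcs_g, simp)
  moreover have "pverts S \<subseteq> pverts G"
    using sub unfolding S_def replace_arc_def verts_g by (auto simp: verts ws_def)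
  moreover have "parcs S \<subseteq> parcs G"
  proof -
    \<comment> \<open>Both shifted lists are indexed by the i < k, so their zip consists of the
      pairs \<open>(f (V i), f (V (Suc i)))\<close>.\<close>
    have fst_list: "f (V 0) # ws = map (\<lambda>i. f (V i)) [0..<k]"
      using \<open>k > 0\<close> by (simp add: ws_def upt_conv_Cons)
    have snd_list: "ws @ [f (V k)] = map (\<lambda>i. f (V (Suc i))) [0..<k]"
    proof -
      obtain m where m: "k = Suc m" using \<open>k > 0\<close> by (cases k) auto
      have "[1..<k] = map Suc [0..<m]" unfolding m by (simp add: map_Suc_upt)
      then have "ws = map (\<lambda>i. f (V (Suc i))) [0..<m]" by (simp add: ws_def)
      then show ?thesis by (simp add: m)
    qed
    have "(f (V i), f (V (Suc i))) \<in> parcs G" if "i < k" for i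
      using that by (intro arcs) (auto simp: D_graph_def)
    then have "set (zip (f (V 0) # ws) (ws @ [f (V k)])) \<subseteq> parcs G"
      unfolding fst_list snd_list by (auto simp: set_zip)
    moreover have "{(f U1, f (V 0)), (f U2, f (V 0)), (f (V k), f W1), (f (V k), f W2)} \<subseteq> parcs G"
      using arcs by (auto simp: D_graph_def)
    ultimately show ?thesis
      unfolding S_def replace_arc_def arcs_g by auto
  qed
  ultimately show ?thesis
    unfolding topological_minor_def digraph_iso_with_proj_iff subgraph_with_proj_iff
    using inj_g wf pair_wf_D_graph by blast
qed

section \<open>Source-sink paths in acyclic digraphs\<close>

context dag
begin

section \<open>Acyclicity and the extraction of a copy of D_k\<close>

lemma acyclic_parcs: "acyclic (parcs G)"
proof (rule acyclicI, rule allI, rule notI)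
  fix x assume "(x, x) \<in> (parcs G)\<^sup>+"
  then obtain p where "awalk x p x" "p \<noteq> []"
    using reachable1_awalk by auto
  then have "closed_w p" by (auto simp: closed_w_def)
  with closed_w_imp_cycle no_cycle show False by blast
qed

text \<open>The length of a walk from \<open>v\<close> to \<open>u\<close> is the index of the copy.
  Apart from the two in-neighbours and the two out-neighbours, which differ by assumption, any two
  vertices in different positions are joined by a nonempty walk, so acyclicity separates
  them.\<close>

lemma merge_split_imp_embeds_D_graph:
  assumes "merge_split (parcs G)"
  shows "\<exists>k f. embeds f (D_graph k) G"
proof -
  let ?A = "parcs G"
  from assms obtain x1 x2 v u w1 w2 where *: "x1 \<noteq> x2" "(x1, v) \<in> ?A" "(x2, v) \<in> ?A"
    "(v, u) \<in> ?A\<^sup>*" "(u, w1) \<in> ?A" "(u, w2) \<in> ?A" "w1 \<noteq> w2" by (rule merge_splitE)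
  from *(4) obtain k where "(v, u) \<in> ?A ^^ k" by (auto simp: rtrancl_power)
  then obtain c where c: "c 0 = v" "c k = u" "\<And>i. i < k \<Longrightarrow> (c i, c (Suc i)) \<in> ?A"
    by (auto simp: relpow_fun_conv)
  have neq: "a \<noteq> b" if "(a, b) \<in> ?A\<^sup>+" for a b
    using acyclic_parcs that by (auto simp: acyclic_def)
  have reach: "(c i, c j) \<in> ?A\<^sup>*" if "i \<le> j" "j \<le> k" for i j
    using that
  proof (induction j rule: dec_induct)
    case (step n)
    with c(3)[of n] show ?case by (auto intro: rtrancl_into_rtrancl)
  qed simp
  have c_neq_less: "c i \<noteq> c j" if "i < j" "j \<le> k" for i j
    using that c(3)[of i] reach[of "Suc i" j] by (intro neq rtrancl_into_trancl2) auto
  have c_neq: "c i = c j \<longleftrightarrow> i = j" if "i \<le> k" "j \<le> k" for i j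
    using that c_neq_less[of i j] c_neq_less[of j i] by (cases i j rule: linorder_cases) auto
  have xc: "(x, c i) \<in> ?A\<^sup>+" if "x \<in> {x1, x2}" "i \<le> k" for x i
    using that * reach[of 0 i] c by (intro rtrancl_into_trancl2) auto
  have cw: "(c i, w) \<in> ?A\<^sup>+" if "w \<in> {w1, w2}" "i \<le> k" for w i
    using that * reach[of i k] c by (intro rtrancl_into_trancl1) auto
  have xw: "(x, w) \<in> ?A\<^sup>+" if "x \<in> {x1, x2}" "w \<in> {w1, w2}" for x w
    using that xc[of x 0] cw[of w 0] by (intro trancl_trans[of x "c 0" _ w]) auto
  define f where "f y = (case y of U1 \<Rightarrow> x1 | U2 \<Rightarrow> x2 | V i \<Rightarrow> c i | W1 \<Rightarrow> w1 | W2 \<Rightarrow> w2)" for y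
  have f: "f U1 = x1" "f U2 = x2" "\<And>i. f (V i) = c i" "f W1 = w1" "f W2 = w2"
    by (simp_all add: f_def)
  have arcs: "map_prod f f ` parcs (D_graph k) \<subseteq> ?A"
    using * c by (auto simp: D_graph_def f)
  have "f ` pverts (D_graph k) \<subseteq> pverts G"
  proof -
    \<comment> \<open>Each \<open>c i\<close> is the head of an arc, also for \<open>i = 0\<close>,
      because \<open>x1\<close> precedes the walk.\<close>
    have "c i \<in> pverts G" if "i \<le> k" for i
      using xc[OF _ that, of x1] by (auto dest!: tranclD2 intro: in_arcsD2)
    then show ?thesis
      using * by (auto simp: D_graph_def f intro: in_arcsD1 in_arcsD2)
  qed
  moreover have "inj_on f (pverts (D_graph k))"
  proof -
    have "f a \<noteq> f b" if "a \<in> pverts (D_graph k)" "b \<in> pverts (D_graph k)" "a \<noteq> b" for a b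
    proof -
      have le: "i \<le> k" if "V i \<in> pverts (D_graph k)" for i
        using that by (auto simp: D_graph_def)
      have neqs: "x1 \<noteq> w1" "x1 \<noteq> w2" "x2 \<noteq> w1" "x2 \<noteq> w2"
        "\<And>i. i \<le> k \<Longrightarrow> x1 \<noteq> c i \<and> x2 \<noteq> c i \<and> w1 \<noteq> c i \<and> w2 \<noteq> c i"
        "\<And>i. i \<le> k \<Longrightarrow> c i \<noteq> x1 \<and> c i \<noteq> x2 \<and> c i \<noteq> w1 \<and> c i \<noteq> w2"
        using xc[THEN neq] cw[THEN neq, symmetric] xw[THEN neq] by blast+
      note neqs = neqs neqs(1-4)[symmetric]
        *(1,7) *(1,7)[symmetric]
      show ?thesis
        using that by (cases a; cases b) (simp_all add: f c_neq neqs le)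
    qed
    then show ?thesis by (auto simp: inj_on_def)
  qed
  ultimately show ?thesis using arcs unfolding embeds_def by blast
qed

section \<open>Sources, sinks and degrees in terms of arcs\<close>

lemma source_iff: "source (with_proj G) v \<longleftrightarrow> v \<in> pverts G \<and> (\<forall>x. (x, v) \<notin> parcs G)"
  \<comment> \<open>An infinite set has cardinality 0, so finiteness is what turns degree 0 into the
    absence of arcs.\<close>
  using finite_in_arcs[of v] by (auto simp: source_def in_degree_def in_arcs_def)

lemma sink_iff: "sink (with_proj G) v \<longleftrightarrow> v \<in> pverts G \<and> (\<forall>x. (v, x) \<notin> parcs G)"
  using finite_out_arcs[of v] by (auto simp: sink_def out_degree_def out_arcs_def)

lemma in_degree_gt_1_iff:
  "in_degree (with_proj G) v > 1 \<longleftrightarrow> (\<exists>x y. x \<noteq> y \<and> (x, v) \<in> parcs G \<and> (y, v) \<in> parcs G)"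
proof -
  have "in_degree (with_proj G) v \<le> Suc 0 \<longleftrightarrow>
    (\<forall>a \<in> in_arcs (with_proj G) v. \<forall>b \<in> in_arcs (with_proj G) v. a = b)"
    unfolding in_degree_def using finite_in_arcs[of v] by (intro card_le_Suc0_iff_eq) auto
  then show ?thesis by (auto simp: in_arcs_def not_le[symmetric])
qed

lemma out_degree_le_1_iff:
  "out_degree (with_proj G) v \<le> 1 \<longleftrightarrow>
     (\<forall>x y. (v, x) \<in> parcs G \<longrightarrow> (v, y) \<in> parcs G \<longrightarrow> x = y)"
proof -
  have "out_degree (with_proj G) v \<le> Suc 0 \<longleftrightarrow>
    (\<forall>a \<in> out_arcs (with_proj G) v. \<forall>b \<in> out_arcs (with_proj G) v. a = b)"
    unfolding out_degree_def using finite_out_arcs[of v] by (intro card_le_Suc0_iff_eq) auto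
  then show ?thesis by (auto simp: out_arcs_def)
qed

lemma merge_split_iff_degrees:
  "merge_split (parcs G) \<longleftrightarrow> \<not> (\<forall>v \<in> verts (with_proj G). in_degree (with_proj G) v > 1 \<longrightarrow>
     (\<forall>u. v \<rightarrow>\<^sup>*\<^bsub>with_proj G\<^esub> u \<longrightarrow> out_degree (with_proj G) u \<le> 1))"
proof -
  \<comment> \<open>Reachability in a digraph is reflexive on vertices only, whereas
    \<open>rtrancl\<close> is reflexive everywhere; the head of an arc is a vertex, so there the two
    agree.\<close>
  have "v \<in> pverts G \<and> v \<rightarrow>\<^sup>*\<^bsub>with_proj G\<^esub> u \<longleftrightarrow> (v, u) \<in> (parcs G)\<^sup>*"
    if "(x, v) \<in> parcs G" for x v u
    using reachable_conv'[of v u] in_arcsD2[OF that] by simp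
  then show ?thesis
    unfolding merge_split_def in_degree_gt_1_iff out_degree_le_1_iff by (simp; blast)
qed

section \<open>Walks between sources and sinks\<close>

text \<open>A repeated vertex would cut out a nonempty closed walk. Hence source-sink paths can be
  handled as walks, which can be joined without checking disjointness.\<close>

lemma apath_iff_awalk: "apath u p v \<longleftrightarrow> awalk u p v"
proof -
  have "distinct (pawalk_verts u p)" if "awalk u p v"
  proof (rule ccontr)
    assume "\<not> distinct (pawalk_verts u p)"
    then obtain r w where "awalk w r w" "r \<noteq> []"
      using awalk_not_distinct_decomp[OF \<open>awalk u p v\<close>] by blast
    then have "(w, w) \<in> (parcs G)\<^sup>+" using reachable1_awalk by blast
    with acyclic_parcs show False by (auto simp: acyclic_def)
  qed
  then show ?thesis by (auto simp: apath_def)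
qed

lemma source_sink_path_iff: "source_sink_path (with_proj G) p \<longleftrightarrow>
  p \<noteq> [] \<and> (\<exists>s t. source (with_proj G) s \<and> sink (with_proj G) t \<and> awalk s p t)"
  by (simp add: source_sink_path_def apath_iff_awalk)

lemma awalk_append_ex_iff: "awalk u (p @ q) v \<longleftrightarrow> (\<exists>w. awalk u p w \<and> awalk w q v)"
  by (metis awalk_append_iff awalk_appendI)

lemma awalk_arc_split:
  assumes "awalk u (p @ (x, y) # q) v"
  shows "awalk u p x" "awalk y q v" "(x, y) \<in> parcs G"
  using assms by (auto simp: awalk_append_ex_iff awalk_Cons_iff)

text \<open>Going backwards along arcs terminates in a finite acyclic digraph: by well-founded
  induction, the walk to a predecessor is extended by one arc.\<close>

lemma ex_source_awalk:
  assumes "v \<in> pverts G"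
  shows "\<exists>s p. source (with_proj G) s \<and> awalk s p v"
proof -
  have "wf (parcs G)" using pair_finite_arcs acyclic_parcs by (rule finite_acyclic_wf)
  then show ?thesis using assms
  proof (induction v rule: wf_induct_rule)
    case (less v)
    show ?case
    proof (cases "source (with_proj G) v")
      case True
      with less.prems show ?thesis
        by (intro exI[of _ v] exI[of _ "[]"]) (auto simp: awalk_Nil_iff)
    next
      case False
      with less.prems obtain x where x: "(x, v) \<in> parcs G" by (auto simp: source_iff)
      with less.IH obtain s p where "source (with_proj G) s" "awalk s p x"
        using in_arcsD1 by blast
      with x have "awalk s (p @ [(x, v)]) v"
        by (auto simp: awalk_append_ex_iff awalk_simps intro: in_arcsD2)
      with \<open>source (with_proj G) s\<close> show ?thesis by blast
    qed
  qed
qed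

lemma ex_sink_awalk:
  assumes "v \<in> pverts G"
  shows "\<exists>t p. sink (with_proj G) t \<and> awalk v p t"
proof -
  \<comment> \<open>With the converse relation the induction hypothesis speaks about
    successors.\<close>
  have "wf ((parcs G)\<inverse>)" using pair_finite_arcs acyclic_parcs by (rule finite_acyclic_wf_converse)
  then show ?thesis using assms
  proof (induction v rule: wf_induct_rule)
    case (less v)
    show ?case
    proof (cases "sink (with_proj G) v")
      case True
      with less.prems show ?thesis
        by (intro exI[of _ v] exI[of _ "[]"]) (auto simp: awalk_Nil_iff)
    next
      case False
      with less.prems obtain x where x: "(v, x) \<in> parcs G" by (auto simp: sink_iff)
      with less.IH obtain t p where "sink (with_proj G) t" "awalk x p t"
        using in_arcsD2 by blast
      with x have "awalk v ((v, x) # p) t" by (auto simp: awalk_simps)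
      with \<open>sink (with_proj G) t\<close> show ?thesis by blast
    qed
  qed
qed

section \<open>A configuration yields a path without private arcs\<close>

lemma merge_split_imp_not_funnel:
  assumes "merge_split (parcs G)"
  shows "\<not> funnel G"
proof
  assume "funnel G"
  from assms obtain x1 x2 v u w1 w2 where *: "x1 \<noteq> x2" "(x1, v) \<in> parcs G" "(x2, v) \<in> parcs G"
    "(v, u) \<in> (parcs G)\<^sup>*" "(u, w1) \<in> parcs G" "(u, w2) \<in> parcs G" "w1 \<noteq> w2"
    by (rule merge_splitE)
  obtain s1 p1 where p1: "source (with_proj G) s1" "awalk s1 p1 x1"
    using ex_source_awalk in_arcsD1 *(2) by blast
  obtain s2 p2 where p2: "source (with_proj G) s2" "awalk s2 p2 x2"
    using ex_source_awalk in_arcsD1 *(3) by blast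
  obtain t1 r1 where r1: "sink (with_proj G) t1" "awalk w1 r1 t1"
    using ex_sink_awalk in_arcsD2 *(5) by blast
  obtain t2 r2 where r2: "sink (with_proj G) t2" "awalk w2 r2 t2"
    using ex_sink_awalk in_arcsD2 *(6) by blast
  obtain q where q: "awalk v q u"
    using reachable_awalk reachable_conv' *(2,4) in_arcsD2 by blast
  \<comment> \<open>Every arc of \<open>?p\<close> lies on one of the other two paths:
    \<open>p1\<close>, \<open>(x1, v)\<close> and \<open>q\<close> are shared with
    \<open>?p_out\<close>, while \<open>q\<close>, \<open>(u, w1)\<close> and \<open>r1\<close> are
    shared with \<open>?p_in\<close>.\<close>
  let ?p = "p1 @ (x1, v) # q @ (u, w1) # r1"
  let ?p_in = "p2 @ (x2, v) # q @ (u, w1) # r1"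
  let ?p_out = "p1 @ (x1, v) # q @ (u, w2) # r2"
  have path: "source_sink_path (with_proj G) ?p" "source_sink_path (with_proj G) ?p_in"
    "source_sink_path (with_proj G) ?p_out"
    unfolding source_sink_path_iff
    by (intro conjI exI[of _ s1] exI[of _ s2] exI[of _ t1] exI[of _ t2];
        use p1 p2 r1 r2 q * in \<open>auto simp: awalk_append_ex_iff awalk_Cons_iff\<close>)+
  with \<open>funnel G\<close> obtain a where a: "a \<in> set ?p" "private_arc (with_proj G) a"
    unfolding funnel_def by blast
  then have uniq: "p = ?p" if "source_sink_path (with_proj G) p" "a \<in> set p" for p
    using path(1) that unfolding private_arc_def by blast
  \<comment> \<open>\<open>p1\<close> and \<open>p2\<close> may have different lengths, so the
    common suffix is cancelled; the last arcs of what remains start at \<open>x2\<close> and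
    \<open>x1\<close>.\<close>
  have "?p_in \<noteq> ?p"
  proof
    assume "?p_in = ?p"
    then have "(p2 @ [(x2, v)]) @ (q @ (u, w1) # r1) = (p1 @ [(x1, v)]) @ (q @ (u, w1) # r1)"
      by simp
    then have "p2 @ [(x2, v)] = p1 @ [(x1, v)]" by (rule append_same_eq[THEN iffD1])
    with *(1) show False by simp
  qed
  moreover have "?p_out \<noteq> ?p" using *(7) by simp
  ultimately have "a \<notin> set ?p_in" "a \<notin> set ?p_out" using uniq path by blast+
  with a(1) show False by auto
qed

section \<open>Private arcs in the absence of configurations\<close>

definition unique_pred :: "'a \<Rightarrow> bool" where
  "unique_pred v \<longleftrightarrow> (\<forall>a b. (a, v) \<in> parcs G \<longrightarrow> (b, v) \<in> parcs G \<longrightarrow> a = b)"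

definition unique_succ :: "'a \<Rightarrow> bool" where
  "unique_succ v \<longleftrightarrow> (\<forall>a b. (v, a) \<in> parcs G \<longrightarrow> (v, b) \<in> parcs G \<longrightarrow> a = b)"

lemma unique_predD: "unique_pred v \<Longrightarrow> (a, v) \<in> parcs G \<Longrightarrow> (b, v) \<in> parcs G \<Longrightarrow> a = b"
  unfolding unique_pred_def by blast

lemma unique_succD: "unique_succ v \<Longrightarrow> (v, a) \<in> parcs G \<Longrightarrow> (v, b) \<in> parcs G \<Longrightarrow> a = b"
  unfolding unique_succ_def by blast

lemma source_unique_pred: "source (with_proj G) v \<Longrightarrow> unique_pred v"
  by (simp add: source_iff unique_pred_def)

lemma sink_unique_succ: "sink (with_proj G) v \<Longrightarrow> unique_succ v"
  by (simp add: sink_iff unique_succ_def)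

text \<open>Traced back from \<open>x\<close>, both walks are forced to use the same arc at each
  step. They end together, since no arc enters a source.\<close>

lemma awalk_from_source_unique:
  assumes "awalk s p x" "awalk s' q x" "source (with_proj G) s" "source (with_proj G) s'"
    and "\<forall>y \<in> insert x (fst ` set p). unique_pred y"
  shows "p = q"
  using assms
proof (induction p arbitrary: q x rule: rev_induct)
  case Nil
  then have "source (with_proj G) x" by (simp add: awalk_Nil_iff)
  with Nil show ?case
    by (cases q rule: rev_cases) (auto simp: awalk_append_ex_iff awalk_simps source_iff)
next
  case (snoc e p)
  obtain y where e: "e = (y, x)" "(y, x) \<in> parcs G" and p: "awalk s p y"
    using snoc.prems(1) by (cases e) (auto simp: awalk_append_ex_iff awalk_simps)
  with snoc.prems(2,4) have "q \<noteq> []" by (auto simp: awalk_Nil_iff source_iff)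
  then obtain q' z where q: "q = q' @ [(z, x)]" "(z, x) \<in> parcs G" and q': "awalk s' q' z"
    using snoc.prems(2) by (cases q rule: rev_cases) (auto simp: awalk_append_ex_iff awalk_simps)
  have "z = y" using snoc.prems(5) e(2) q(2) by (auto dest: unique_predD)
  with q' have "awalk s' q' y" by simp
  have "p = q'"
    by (rule snoc.IH[OF p \<open>awalk s' q' y\<close> snoc.prems(3,4)]) (use snoc.prems(5) e in auto)
  with e q \<open>z = y\<close> show ?case by simp
qed

text \<open>The mirror image: traced forward from the common start, every arc is forced, and no arc
  leaves a sink.\<close>

lemma awalk_to_sink_unique:
  assumes "awalk x p t" "awalk x q t'" "sink (with_proj G) t" "sink (with_proj G) t'"
    and "\<forall>y \<in> insert x (snd ` set p). unique_succ y"
  shows "p = q"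
  using assms
proof (induction p arbitrary: q x)
  case Nil
  then have "sink (with_proj G) x" by (simp add: awalk_Nil_iff)
  with Nil show ?case by (cases q) (auto simp: awalk_simps sink_iff)
next
  case (Cons e p)
  obtain y where e: "e = (x, y)" "(x, y) \<in> parcs G" and p: "awalk y p t"
    using Cons.prems(1) by (cases e) (auto simp: awalk_simps)
  with Cons.prems(2,4) have "q \<noteq> []" by (auto simp: awalk_Nil_iff sink_iff)
  then obtain q' z where q: "q = (x, z) # q'" "(x, z) \<in> parcs G" and q': "awalk z q' t'"
    using Cons.prems(2) by (cases q) (auto simp: awalk_simps)
  have "z = y" using Cons.prems(5) e(2) q(2) by (auto dest: unique_succD)
  with q' have "awalk y q' t'" by simp
  have "p = q'"
    by (rule Cons.IH[OF p \<open>awalk y q' t'\<close> Cons.prems(3,4)]) (use Cons.prems(5) e in auto)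
  with e q \<open>z = y\<close> show ?case by simp
qed

text \<open>The arc is the one entering the first vertex with two in-arcs, or the last arc if no
  such vertex exists. The assumption on \<open>s\<close> is the invariant that the induction carries
  along the walk.\<close>

lemma awalk_split_at_unique_arc:
  assumes "\<not> merge_split (parcs G)" "awalk s p t" "sink (with_proj G) t" "p \<noteq> []"
    and "unique_pred s"
  shows "\<exists>p1 x y p2. p = p1 @ (x, y) # p2 \<and> (\<forall>z \<in> insert x (fst ` set p1). unique_pred z) \<and>
    (\<forall>z \<in> insert y (snd ` set p2). unique_succ z)"
  using assms(2-)
proof (induction p arbitrary: s)
  case (Cons e p)
  obtain y where e: "e = (s, y)" and p: "awalk y p t"
    using Cons.prems(1) by (cases e) (auto simp: awalk_simps)
  show ?case
  proof (cases "unique_pred y")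
    case False
    \<comment> \<open>Here \<open>y\<close> has two in-neighbours, and it reaches every later
      vertex; none of these can have two out-neighbours.\<close>
    have "(y, z) \<in> (parcs G)\<^sup>*" if "z \<in> insert y (snd ` set p)" for z
    proof (cases "z = y")
      case False
      with that obtain x p1 p2 where "p = p1 @ (x, z) # p2" by (fastforce dest: split_list)
      with p have "awalk y p1 x" "(x, z) \<in> parcs G" by (auto dest: awalk_arc_split)
      then have "awalk y (p1 @ [(x, z)]) z"
        by (auto simp: awalk_append_ex_iff awalk_simps intro: in_arcsD2)
      then show ?thesis using reachable_awalk reachable_conv by blast
    qed simp
    with False assms(1) have "\<forall>z \<in> insert y (snd ` set p). unique_succ z"
      unfolding merge_split_def unique_pred_def unique_succ_def by blast
    with e Cons.prems(4) show ?thesis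
      by (intro exI[of _ "[]"] exI[of _ s] exI[of _ y] exI[of _ p]) auto
  next
    case uniq: True
    show ?thesis
    proof (cases "p = []")
      case True
      with p have "y = t" by (simp add: awalk_Nil_iff)
      with True e Cons.prems(2,4) show ?thesis
        by (intro exI[of _ "[]"] exI[of _ s] exI[of _ y]) (auto simp: sink_unique_succ)
    next
      case False
      from Cons.IH[OF p Cons.prems(2) False] uniq obtain p1 x z p2 where
        "p = p1 @ (x, z) # p2"
        "\<forall>w \<in> insert x (fst ` set p1). unique_pred w"
        "\<forall>w \<in> insert z (snd ` set p2). unique_succ w"
        by blast
      with e Cons.prems(4) show ?thesis
        by (intro exI[of _ "e # p1"] exI[of _ x] exI[of _ z] exI[of _ p2]) auto
    qed
  qed
qed simp

lemma funnel_if_not_merge_split: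
  assumes "\<not> merge_split (parcs G)"
  shows "funnel G"
  unfolding funnel_def
proof (intro conjI allI impI)
  show "dag G" ..
  fix p assume path: "source_sink_path (with_proj G) p"
  then obtain s t where st: "source (with_proj G) s" "sink (with_proj G) t" "awalk s p t" "p \<noteq> []"
    unfolding source_sink_path_iff by blast
  from awalk_split_at_unique_arc[OF assms st(3,2,4) source_unique_pred[OF st(1)]] obtain p1 x y p2 where p:
    "p = p1 @ (x, y) # p2"
    "\<forall>z \<in> insert x (fst ` set p1). unique_pred z" "\<forall>z \<in> insert y (snd ` set p2). unique_succ z"
    by blast
  note p_split = awalk_arc_split[OF st(3)[unfolded p(1)]]
  \<comment> \<open>A source-sink path through \<open>(x, y)\<close> is forced backwards from
    \<open>x\<close> by unique predecessors and forwards from \<open>y\<close> by unique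
    successors.\<close>
  have "q = p" if "source_sink_path (with_proj G) q" "(x, y) \<in> set q" for q
  proof -
    from that(1) obtain s' t' where st': "source (with_proj G) s'" "sink (with_proj G) t'"
      "awalk s' q t'" unfolding source_sink_path_iff by blast
    from that(2) obtain q1 q2 where q: "q = q1 @ (x, y) # q2" by (auto dest: split_list)
    note q_split = awalk_arc_split[OF st'(3)[unfolded q]]
    have "p1 = q1"
      by (rule awalk_from_source_unique[OF p_split(1) q_split(1) st(1) st'(1) p(2)])
    moreover have "p2 = q2"
      by (rule awalk_to_sink_unique[OF p_split(2) q_split(2) st(2) st'(2) p(3)])
    ultimately show ?thesis using p(1) q by simp
  qed
  moreover have "(x, y) \<in> set p" using p(1) by simp
  ultimately have "private_arc (with_proj G) (x, y)"
    using path p_split(3) unfolding private_arc_def by (auto intro!: ex1I[of _ p])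
  then show "\<exists>a \<in> set p. private_arc (with_proj G) a" using p(1) by auto
qed

end

section \<open>Equivalence of the four conditions\<close>

theorem theorem1:
  fixes D :: "'a pair_pre_digraph"
  assumes "dag D"
  shows "(funnel D \<longleftrightarrow>
           (\<forall>v \<in> verts (with_proj D). in_degree (with_proj D) v > 1 \<longrightarrow>
             (\<forall>u. v \<rightarrow>\<^sup>*\<^bsub>with_proj D\<^esub> u \<longrightarrow> out_degree (with_proj D) u \<le> 1))) \<and>
         (funnel D \<longleftrightarrow> (\<forall>k. \<not> has_subgraph_iso D (D_graph k))) \<and>
         (funnel D \<longleftrightarrow>
           \<not> topological_minor (D_graph 0) D \<and> \<not> topological_minor (D_graph 1) D)"
proof -
  interpret dag D by fact
  have wf: "pair_wf_digraph D" ..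
  \<comment> \<open>Each condition is compared with \<open>merge_split\<close> alone, in place of a
    cycle of implications.\<close>
  have funnel: "funnel D \<longleftrightarrow> \<not> merge_split (parcs D)"
    using merge_split_imp_not_funnel funnel_if_not_merge_split by blast
  have "(\<exists>k. has_subgraph_iso D (D_graph k)) \<longleftrightarrow> merge_split (parcs D)"
    using has_subgraph_iso_D_graph_imp_merge_split merge_split_imp_embeds_D_graph
      embeds_imp_has_subgraph_iso[OF _ pair_wf_D_graph wf] by blast
  moreover have "topological_minor (D_graph 0) D \<or> topological_minor (D_graph 1) D \<longleftrightarrow>
    merge_split (parcs D)"
  proof
    assume "merge_split (parcs D)"
    then obtain k f where "embeds f (D_graph k) D" using merge_split_imp_embeds_D_graph by blast
    \<comment> \<open>For \<open>k = 0\<close> the merging and the splitting vertex coincide, so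
      there is no arc between them to subdivide and D_0 itself is the minor; all other cases give
      D_1.\<close>
    then show "topological_minor (D_graph 0) D \<or> topological_minor (D_graph 1) D"
      using embeds_imp_topological_minor[OF _ pair_wf_D_graph wf]
        embeds_D_graph_imp_topological_minor[OF _ _ wf] by (cases "k = 0") auto
  qed (use topological_minor_D_graph_imp_merge_split in blast)
  ultimately show ?thesis using funnel merge_split_iff_degrees by blast
qed

end
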